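(* Fix $t\ge1$, $\Delta\ge 0$ and a sample index $j$. Let $(\mathbf{x}_{t-1}^{(j)},w_{t-1}^{(j)})$ be properly weighted with respect to $\pi_{t-1}(\mathbf{x}_{t-1})$. Let $x_t^{(2,j)}$ be generated from a trial distribution $q_t(x_t\mid\mathbf{x}_{t-1}^{(j)})$ which does not depend on $y_{t+1},\dots,y_{t+\Delta}$, put $\mathbf{x}_t^{(2,j)}=(\mathbf{x}_{t-1}^{(j)},x_t^{(2,j)})$ and $$w_t^{(2,j)}=w_{t-1}^{(j)}\,\frac{\pi_{t+\Delta}(\mathbf{x}_t^{(2,j)})}{\pi_{t-1}(\mathbf{x}_{t-1}^{(j)})\,q_t(x_t^{(2,j)}\mid\mathbf{x}_{t-1}^{(j)})}.$$ Let $\mathbf{x}_t^{(3,j)}=\mathbf{x}_t^{(2,j)}$, generate $x_{t+1}^{(3,j)},\dots,x_{t+\Delta}^{(3,j)}$ sequentially from $\prod_{s=t+1}^{t+\Delta}q_s(x_s\mid\mathbf{x}_t^{(3,j)},x_{t+1},\dots,x_{s-1})$, put $\mathbf{x}_{s}^{(3,j)}=(\mathbf{x}_{s-1}^{(3,j)},x_s^{(3,j)})$ for $t+1\le s\le t+\Delta$, and define the lookahead weighting weight $$w_t^{(3,j)}=w_{t-1}^{(j)}\,\frac{\pi_{t+\Delta}(\mathbf{x}_{t+\Delta}^{(3,j)})}{\pi_{t-1}(\mathbf{x}_{t-1}^{(j)})\prod_{s=t}^{t+\Delta}q_s(x_s^{(3,j)}\mid\mathbf{x}_{s-1}^{(3,j)})},$$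 where $\mathbf{x}_{t-1}^{(3,j)}=\mathbf{x}_{t-1}^{(j)}$ and $x_t^{(3,j)}=x_t^{(2,j)}$. Then $$\operatorname{var}_{\pi_{t+\Delta}}\big(w_t^{(3,j)}\big)\ \ge\ \operatorname{var}_{\pi_{t+\Delta}}\big(w_t^{(2,j)}\big),$$ and for any square integrable function $h(\mathbf{x}_t)$, $$\operatorname{var}_{\pi_{t+\Delta}}\big[w_t^{(3,j)}h(\mathbf{x}_{t-1}^{(j)},x_t^{(2,j)})\big]\ \ge\ \operatorname{var}_{\pi_{t+\Delta}}\big[w_t^{(2,j)}h(\mathbf{x}_{t-1}^{(j)},x_t^{(2,j)})\big].$$
   Context: Latent states $x_0,x_1,\dots$ and observations $y_1,y_2,\dots$ have a joint distribution with densities with respect to fixed $\sigma$-finite (product) measures. Write $\mathbf{x}_t=(x_0,\dots,x_t)$, $\mathbf{y}_t=(y_1,\dots,y_t)$ and $\pi_t(\mathbf{x}_t)=p(\mathbf{x}_t\mid\mathbf{y}_t)$. For any times $s,t$, $\pi_t(\mathbf{x}_s)=p(\mathbf{x}_s\mid\mathbf{y}_t)$ is the conditional density of $\mathbf{x}_s$ given $\mathbf{y}_t$, and $\pi_t(x_s\mid\mathbf{x}_{s-1})=p(x_s\mid\mathbf{x}_{s-1},\mathbf{y}_t)$. Properly weighted: $(\mathbf{x}_{t-1}^{(j)},w_{t-1}^{(j)})$ is properly weighted with respect to $\pi_{t-1}(\mathbf{x}_{t-1})$ if $\mathbf{x}_{t-1}^{(j)}$ is drawn from a trial density $r_{t-1}$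 whose support covers that of $\pi_{t-1}$, and $w_{t-1}^{(j)}=\pi_{t-1}(\mathbf{x}_{t-1}^{(j)})/r_{t-1}(\mathbf{x}_{t-1}^{(j)})$. The subscript $\pi_{t+\Delta}$ on $\operatorname{var}$ means that the variance is taken conditional on $\mathbf{y}_{t+\Delta}$ (randomness comes from the Monte Carlo samples). "Square integrable" means $E[h(\mathbf{x}_t)^2\mid\mathbf{y}_{t+\Delta}]<\infty$. As always in importance sampling, trial densities have supports covering those of the targets: $q_t(\cdot\mid\mathbf{x}_{t-1})$ covers $\pi_{t+\Delta}(\cdot\mid\mathbf{x}_{t-1})$ and $\prod_{s=t+1}^{t+\Delta}q_s$ covers the conditional density of $(x_{t+1},\dots,x_{t+\Delta})$ given $\mathbf{x}_t$ under $\pi_{t+\Delta}$. Ratios with zero numerator are read as $0$; variances may take the value $+\infty$. *)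

theory Defs
  imports "HOL-Probability.Probability"
begin

definition traj :: "nat set \<Rightarrow> (nat \<Rightarrow> 'w \<Rightarrow> 'a) \<Rightarrow> 'w \<Rightarrow> nat \<Rightarrow> 'a" where
  "traj I Z \<omega> = (\<lambda>i\<in>I. Z i \<omega>)"

text \<open>
  Latent states \<open>X 0, X 1, \<dots>\<close> and observations \<open>Y 1, Y 2, \<dots>\<close>, with reference measures \<open>M i\<close> and
  \<open>N i\<close>. For every horizon \<open>T\<close>, \<open>f T\<close> is a joint density of \<open>(X 0, \<dots>, X T)\<close> and
  \<open>(Y 1, \<dots>, Y T)\<close>. No Markov property is assumed.
\<close>

locale latent_model = prob_space P
  for P :: "'p measure" +
  fixes M :: "nat \<Rightarrow> 'a measure" and N :: "nat \<Rightarrow> 'b measure"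
    and X :: "nat \<Rightarrow> 'p \<Rightarrow> 'a" and Y :: "nat \<Rightarrow> 'p \<Rightarrow> 'b"
    and f :: "nat \<Rightarrow> (nat \<Rightarrow> 'a) \<times> (nat \<Rightarrow> 'b) \<Rightarrow> ennreal"
  assumes sigma_finite_M: "\<And>i. sigma_finite_measure (M i)"
    and sigma_finite_N: "\<And>i. sigma_finite_measure (N i)"
    and joint_density: "\<And>T. distributed P (Pi\<^sub>M {..T} M \<Otimes>\<^sub>M Pi\<^sub>M {1..T} N)
          (\<lambda>\<omega>. (traj {..T} X \<omega>, traj {1..T} Y \<omega>)) (f T)"

text \<open>
  The density \<open>p(x\<^sub>0, \<dots>, x\<^sub>s, y\<^sub>1, \<dots>, y\<^sub>t)\<close>, where the remaining coordinates up to the horizon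
  \<open>max s t\<close> are integrated out. The use of \<open>merge\<close> makes the value depend only on the coordinates
  \<open>0, \<dots>, s\<close> of \<open>x\<close> and \<open>1, \<dots>, t\<close> of \<open>y\<close>.
\<close>

definition joint_dens ::
  "(nat \<Rightarrow> 'a measure) \<Rightarrow> (nat \<Rightarrow> 'b measure) \<Rightarrow> (nat \<Rightarrow> (nat \<Rightarrow> 'a) \<times> (nat \<Rightarrow> 'b) \<Rightarrow> ennreal)
    \<Rightarrow> nat \<Rightarrow> nat \<Rightarrow> (nat \<Rightarrow> 'b) \<Rightarrow> (nat \<Rightarrow> 'a) \<Rightarrow> ennreal" where
  "joint_dens M N f t s y x =
    (let T = max s t in
      \<integral>\<^sup>+u. (\<integral>\<^sup>+v. f T (merge {..s} {s<..T} (x, u), merge {1..t} {t<..T} (y, v)) \<partial>Pi\<^sub>M {t<..T} N)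
        \<partial>Pi\<^sub>M {s<..T} M)"

definition obs_dens ::
  "(nat \<Rightarrow> 'a measure) \<Rightarrow> (nat \<Rightarrow> 'b measure) \<Rightarrow> (nat \<Rightarrow> (nat \<Rightarrow> 'a) \<times> (nat \<Rightarrow> 'b) \<Rightarrow> ennreal)
    \<Rightarrow> nat \<Rightarrow> (nat \<Rightarrow> 'b) \<Rightarrow> ennreal" where
  "obs_dens M N f t y = (\<integral>\<^sup>+x. joint_dens M N f t t y x \<partial>Pi\<^sub>M {..t} M)"

text \<open>\<open>post M N f t s y x\<close> is \<open>p(x\<^sub>0, \<dots>, x\<^sub>s | y\<^sub>1, \<dots>, y\<^sub>t)\<close>.\<close>

definition post ::
  "(nat \<Rightarrow> 'a measure) \<Rightarrow> (nat \<Rightarrow> 'b measure) \<Rightarrow> (nat \<Rightarrow> (nat \<Rightarrow> 'a) \<times> (nat \<Rightarrow> 'b) \<Rightarrow> ennreal)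
    \<Rightarrow> nat \<Rightarrow> nat \<Rightarrow> (nat \<Rightarrow> 'b) \<Rightarrow> (nat \<Rightarrow> 'a) \<Rightarrow> real" where
  "post M N f t s y x = enn2real (joint_dens M N f t s y x / obs_dens M N f t y)"

text \<open>
  \<open>post_cond M N f t r s y x\<close> is \<open>p(x\<^bsub>r+1\<^esub>, \<dots>, x\<^sub>s | x\<^sub>0, \<dots>, x\<^sub>r, y\<^sub>1, \<dots>, y\<^sub>t)\<close> for \<open>r \<le> s\<close>.
\<close>

definition post_cond ::
  "(nat \<Rightarrow> 'a measure) \<Rightarrow> (nat \<Rightarrow> 'b measure) \<Rightarrow> (nat \<Rightarrow> (nat \<Rightarrow> 'a) \<times> (nat \<Rightarrow> 'b) \<Rightarrow> ennreal)
    \<Rightarrow> nat \<Rightarrow> nat \<Rightarrow> nat \<Rightarrow> (nat \<Rightarrow> 'b) \<Rightarrow> (nat \<Rightarrow> 'a) \<Rightarrow> real" where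
  "post_cond M N f t r s y x =
    post M N f t s y (restrict x {..s}) / post M N f t r y (restrict x {..r})"

text \<open>Supports are compared up to null sets of the reference measure.\<close>

definition supp_covers :: "'c measure \<Rightarrow> ('c \<Rightarrow> real) \<Rightarrow> ('c \<Rightarrow> real) \<Rightarrow> bool" where
  "supp_covers S r p \<longleftrightarrow> (AE z in S. p z > 0 \<longrightarrow> r z > 0)"

definition properly_weighted ::
  "'w measure \<Rightarrow> 'c measure \<Rightarrow> ('w \<Rightarrow> 'c) \<Rightarrow> ('w \<Rightarrow> real) \<Rightarrow> ('c \<Rightarrow> real) \<Rightarrow> bool" where
  "properly_weighted Q S x w p \<longleftrightarrow>
    (\<exists>r. (\<forall>z\<in>space S. 0 \<le> r z) \<and> distributed Q S x (\<lambda>z. ennreal (r z)) \<and> supp_covers S r p \<and>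
         (\<forall>\<omega>\<in>space Q. w \<omega> = p (x \<omega>) / r (x \<omega>)))"

text \<open>A conditional density \<open>k(x\<^sub>s | x\<^sub>0, \<dots>, x\<^bsub>s-1\<^esub>)\<close>, for \<open>s \<ge> 1\<close>.\<close>

definition trial_density ::
  "(nat \<Rightarrow> 'a measure) \<Rightarrow> nat \<Rightarrow> ((nat \<Rightarrow> 'a) \<Rightarrow> 'a \<Rightarrow> real) \<Rightarrow> bool" where
  "trial_density M s k \<longleftrightarrow>
    (\<lambda>(z, v). k z v) \<in> borel_measurable (Pi\<^sub>M {..s - 1} M \<Otimes>\<^sub>M M s) \<and>
    (\<forall>z\<in>space (Pi\<^sub>M {..s - 1} M).
       (\<forall>v\<in>space (M s). 0 \<le> k z v) \<and> (\<integral>\<^sup>+v. ennreal (k z v) \<partial>M s) = 1)"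

text \<open>
  For \<open>s \<ge> 1\<close>: given \<open>(x 0, \<dots>, x (s - 1))\<close>, the variable \<open>x s\<close> has conditional density \<open>k\<close>
  with respect to \<open>M s\<close>, stated through the joint law of \<open>(x 0, \<dots>, x s)\<close>.
\<close>

definition drawn_from ::
  "'w measure \<Rightarrow> (nat \<Rightarrow> 'a measure) \<Rightarrow> nat \<Rightarrow> (nat \<Rightarrow> 'w \<Rightarrow> 'a)
    \<Rightarrow> ((nat \<Rightarrow> 'a) \<Rightarrow> 'a \<Rightarrow> real) \<Rightarrow> bool" where
  "drawn_from Q M s x k \<longleftrightarrow>
    traj {..s} x \<in> measurable Q (Pi\<^sub>M {..s} M) \<and>
    (\<forall>A\<in>sets (Pi\<^sub>M {..s} M).
       emeasure (distr Q (Pi\<^sub>M {..s} M) (traj {..s} x)) A =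
       (\<integral>\<^sup>+\<omega>. (\<integral>\<^sup>+v. ennreal (k (traj {..s - 1} x \<omega>) v)
                    * indicator A ((traj {..s - 1} x \<omega>)(s := v)) \<partial>M s) \<partial>Q))"

definition no_lookahead ::
  "(nat \<Rightarrow> 'b measure) \<Rightarrow> nat \<Rightarrow> nat \<Rightarrow> ((nat \<Rightarrow> 'b) \<Rightarrow> 'c) \<Rightarrow> bool" where
  "no_lookahead N t T k \<longleftrightarrow>
    (\<forall>y\<in>space (Pi\<^sub>M {1..T} N). \<forall>y'\<in>space (Pi\<^sub>M {1..T} N).
       restrict y {1..t} = restrict y' {1..t} \<longrightarrow> k y = k y')"

text \<open>
  Variance with values in \<open>[0, \<infinity>]\<close>. On a probability space the value is \<open>\<infinity>\<close> for a measurable \<open>Z\<close>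
  that is not square integrable, including the case where \<open>Z\<close> is not integrable and the
  Bochner integral defaults to \<open>0\<close>.
\<close>

definition ext_variance :: "'w measure \<Rightarrow> ('w \<Rightarrow> real) \<Rightarrow> ennreal" where
  "ext_variance Q Z = (\<integral>\<^sup>+\<omega>. ennreal ((Z \<omega> - (\<integral>\<omega>'. Z \<omega>' \<partial>Q))\<^sup>2) \<partial>Q)"

end

(*
  Where the trial densities are positive, the factor r of the proposal cancels, so that integrating
  w3 * g(x_t) over the trajectory law gives the integral of pi_(t+Delta)(x_(t+Delta)) * g(x_t) over
  {r, pi_(t-1), q_t > 0}; integrating out the future gives the same expression for w2. Thus w2 is
  the conditional expectation of w3 given x_t, and conditioning cannot increase the variance. The
  support condition on the future trial densities ensures that no mass is lost in the cancellation.
*)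

theory Submission
  imports Defs
begin

section \<open>Extended variance\<close>

text \<open>Variances may be infinite, so the conditional expectation enters as an identity of
  integrals in [0, \<infinity>] against all nonnegative test functions of x_t, which can be stated
  before any integrability is known. It gives equal means, so that comparing variances reduces to
  comparing second moments. With W for the finer and V for the coarser variable, 2 W V \<le> W^2 +
  V^2 is integrated, the identity turns E(W V) into E(V^2), and one E(V^2) is cancelled; the
  cancellation needs a finite value and forces a truncation. The other obstacle is that y is one
  fixed point. Identities between densities then hold only almost everywhere in x, and the total
  operations have defaults: division by zero gives 0 and \<open>enn2real\<close> sends \<infinity>
  to 0. The factors of a weight therefore cancel against the proposal only up to an indicator. The
  future can be integrated out only if this indicator is a function of x_t, and the zeros of the
  future trial densities are the one part of it that is not.\<close>

lemma (in prob_space) square_integrable_of_ext_variance: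
  fixes Z :: "'a \<Rightarrow> real"
  assumes [measurable]: "Z \<in> borel_measurable M"
    and fin: "ext_variance M Z < \<infinity>"
  shows "(\<integral>\<^sup>+\<omega>. ennreal ((Z \<omega>)\<^sup>2) \<partial>M) < \<infinity>"
proof -
  \<comment> \<open>\<open>c\<close> is whatever the Bochner integral returns, possibly its default
    0. The bound used below holds for every real \<open>c\<close>, being a rearrangement of (Z -
    2c)^2 \<ge> 0.\<close>
  define c where "c = (\<integral>\<omega>. Z \<omega> \<partial>M)"
  have "(\<integral>\<^sup>+\<omega>. ennreal ((Z \<omega>)\<^sup>2) \<partial>M) \<le>
      (\<integral>\<^sup>+\<omega>. 2 * ennreal ((Z \<omega> - c)\<^sup>2) + ennreal (2 * c\<^sup>2) \<partial>M)"
  proof (rule nn_integral_mono)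
    fix \<omega>
    have "(Z \<omega>)\<^sup>2 \<le> 2 * (Z \<omega> - c)\<^sup>2 + 2 * c\<^sup>2"
      using zero_le_power2[of "Z \<omega> - 2 * c"] by (simp add: power2_eq_square algebra_simps)
    then have "ennreal ((Z \<omega>)\<^sup>2) \<le> ennreal (2 * (Z \<omega> - c)\<^sup>2 + 2 * c\<^sup>2)"
      by (rule ennreal_leI)
    also have "\<dots> = 2 * ennreal ((Z \<omega> - c)\<^sup>2) + ennreal (2 * c\<^sup>2)"
      by (simp add: ennreal_plus ennreal_mult)
    finally show "ennreal ((Z \<omega>)\<^sup>2) \<le> 2 * ennreal ((Z \<omega> - c)\<^sup>2) + ennreal (2 * c\<^sup>2)" .
  qed
  also have "\<dots> = 2 * ext_variance M Z + ennreal (2 * c\<^sup>2)"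
    by (subst nn_integral_add)
      (simp_all add: nn_integral_cmult ext_variance_def c_def emeasure_space_1)
  also have "\<dots> < \<infinity>"
    using fin by (simp add: ennreal_mult_less_top)
  finally show ?thesis .
qed

text \<open>Square integrability on a probability space makes the mean a genuine one, so the usual
  formula applies. The second moment is left as a \<open>nn_integral\<close>, the form in which
  second moments are compared later.\<close>

lemma (in prob_space) ext_variance_square_integrable:
  fixes Z :: "'a \<Rightarrow> real"
  assumes Z [measurable]: "Z \<in> borel_measurable M"
    and fin: "(\<integral>\<^sup>+\<omega>. ennreal ((Z \<omega>)\<^sup>2) \<partial>M) < \<infinity>"
  shows "integrable M Z"
    and "ext_variance M Z =
      ennreal (enn2real (\<integral>\<^sup>+\<omega>. ennreal ((Z \<omega>)\<^sup>2) \<partial>M) - (\<integral>\<omega>. Z \<omega> \<partial>M)\<^sup>2)"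
proof -
  have sq: "integrable M (\<lambda>\<omega>. (Z \<omega>)\<^sup>2)"
    using fin by (intro integrableI_bounded) simp_all
  show int: "integrable M Z"
    using Z sq by (rule square_integrable_imp_integrable)
  have "integrable M (\<lambda>\<omega>. (Z \<omega> - expectation Z)\<^sup>2)"
    unfolding power2_diff using sq int by simp
  then have "ext_variance M Z = ennreal (variance Z)"
    unfolding ext_variance_def by (rule nn_integral_eq_integral) simp
  also have "variance Z = expectation (\<lambda>\<omega>. (Z \<omega>)\<^sup>2) - (expectation Z)\<^sup>2"
    using int sq by (rule variance_eq)
  also have "expectation (\<lambda>\<omega>. (Z \<omega>)\<^sup>2) = enn2real (\<integral>\<^sup>+\<omega>. ennreal ((Z \<omega>)\<^sup>2) \<partial>M)"
    by (rule integral_eq_nn_integral) simp_all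
  finally show "ext_variance M Z =
      ennreal (enn2real (\<integral>\<^sup>+\<omega>. ennreal ((Z \<omega>)\<^sup>2) \<partial>M) - (\<integral>\<omega>. Z \<omega> \<partial>M)\<^sup>2)" .
qed

text \<open>
  The hypothesis \<open>tower\<close> says that \<open>v \<circ> \<xi>\<close> is the conditional expectation of \<open>W\<close> given \<open>\<xi>\<close>,
  without assuming that \<open>W\<close> is integrable.
\<close>

lemma (in prob_space) second_moment_tower_le:
  fixes W :: "'a \<Rightarrow> real" and v :: "'c \<Rightarrow> real" and h :: "'c \<Rightarrow> real"
  assumes \<xi> [measurable]: "\<xi> \<in> M \<rightarrow>\<^sub>M S"
    and W [measurable]: "W \<in> borel_measurable M" and v [measurable]: "v \<in> borel_measurable S"
    and h [measurable]: "h \<in> borel_measurable S"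
    and W_nn: "\<And>\<omega>. \<omega> \<in> space M \<Longrightarrow> 0 \<le> W \<omega>" and v_nn: "\<And>z. z \<in> space S \<Longrightarrow> 0 \<le> v z"
    and tower: "\<And>g. g \<in> borel_measurable S \<Longrightarrow>
      (\<integral>\<^sup>+\<omega>. ennreal (W \<omega>) * g (\<xi> \<omega>) \<partial>M) = (\<integral>\<^sup>+\<omega>. ennreal (v (\<xi> \<omega>)) * g (\<xi> \<omega>) \<partial>M)"
  shows "(\<integral>\<^sup>+\<omega>. ennreal ((v (\<xi> \<omega>) * h (\<xi> \<omega>))\<^sup>2) \<partial>M) \<le> (\<integral>\<^sup>+\<omega>. ennreal ((W \<omega> * h (\<xi> \<omega>))\<^sup>2) \<partial>M)"
    (is "?V \<le> ?W")
proof -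
  have \<xi>_in: "\<xi> \<omega> \<in> space S" if "\<omega> \<in> space M" for \<omega>
    using that \<xi> by (rule measurable_space[rotated])
  \<comment> \<open>The cut is on \<open>v * h\<close> and not on \<open>W\<close>: only functions
    of \<open>\<xi>\<close> are admissible in \<open>tower\<close>.\<close>
  define B :: "nat \<Rightarrow> 'c set" where "B n = {z \<in> space S. (v z * h z)\<^sup>2 \<le> real n}" for n
  have [measurable]: "B n \<in> sets S" for n
    unfolding B_def by measurable
  \<comment> \<open>On \<open>B n\<close> the second moment of \<open>v \<circ> \<xi>\<close> is finite, so it can be cancelled after integrating \<open>2 W V \<le> W\<^sup>2 + V\<^sup>2\<close>.\<close>
  have trunc: "(\<integral>\<^sup>+\<omega>. ennreal ((v (\<xi> \<omega>) * h (\<xi> \<omega>))\<^sup>2) * indicator (B n) (\<xi> \<omega>) \<partial>M) \<le> ?W"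
    (is "?a \<le> ?W") for n
  proof -
    have "?a \<le> (\<integral>\<^sup>+\<omega>. ennreal (real n) \<partial>M)"
      by (intro nn_integral_mono) (auto simp: B_def indicator_def intro!: ennreal_leI)
    also have "\<dots> < \<infinity>"
      by (simp add: emeasure_space_1)
    finally have a_fin: "?a < \<infinity>" .
    \<comment> \<open>One factor \<open>v\<close> is split off; what remains,
      \<open>v * h\<^sup>2\<close> on \<open>B n\<close>, serves as the test function.
      \<open>tower\<close> then replaces the split factor by \<open>W\<close> and produces the mixed
      moment.\<close>
    have "?a = (\<integral>\<^sup>+\<omega>. ennreal (v (\<xi> \<omega>)) * (ennreal (v (\<xi> \<omega>) * (h (\<xi> \<omega>))\<^sup>2) * indicator (B n) (\<xi> \<omega>)) \<partial>M)"
    proof (rule nn_integral_cong)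
      fix \<omega> assume "\<omega> \<in> space M"
      then have "0 \<le> v (\<xi> \<omega>)"
        by (intro v_nn \<xi>_in)
      moreover have "(v (\<xi> \<omega>) * h (\<xi> \<omega>))\<^sup>2 = v (\<xi> \<omega>) * (v (\<xi> \<omega>) * (h (\<xi> \<omega>))\<^sup>2)"
        by (simp add: power2_eq_square)
      ultimately show "ennreal ((v (\<xi> \<omega>) * h (\<xi> \<omega>))\<^sup>2) * indicator (B n) (\<xi> \<omega>) =
          ennreal (v (\<xi> \<omega>)) * (ennreal (v (\<xi> \<omega>) * (h (\<xi> \<omega>))\<^sup>2) * indicator (B n) (\<xi> \<omega>))"
        by (simp only: ennreal_mult' mult.assoc)
    qed
    also have "\<dots> = (\<integral>\<^sup>+\<omega>. ennreal (W \<omega>) * (ennreal (v (\<xi> \<omega>) * (h (\<xi> \<omega>))\<^sup>2) * indicator (B n) (\<xi> \<omega>)) \<partial>M)"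
      by (rule tower[symmetric]) measurable
    finally have a_eq: "?a = \<dots>" .
    have "?a + ?a = 2 * (\<integral>\<^sup>+\<omega>. ennreal (W \<omega>) * (ennreal (v (\<xi> \<omega>) * (h (\<xi> \<omega>))\<^sup>2) * indicator (B n) (\<xi> \<omega>)) \<partial>M)"
      unfolding a_eq by (simp add: mult_2)
    also have "\<dots> = (\<integral>\<^sup>+\<omega>. 2 * (ennreal (W \<omega>) * (ennreal (v (\<xi> \<omega>) * (h (\<xi> \<omega>))\<^sup>2) * indicator (B n) (\<xi> \<omega>))) \<partial>M)"
      by (rule nn_integral_cmult[symmetric]) measurable
    also have "\<dots> \<le> (\<integral>\<^sup>+\<omega>. ennreal ((W \<omega> * h (\<xi> \<omega>))\<^sup>2) +
        ennreal ((v (\<xi> \<omega>) * h (\<xi> \<omega>))\<^sup>2) * indicator (B n) (\<xi> \<omega>) \<partial>M)"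
    proof (rule nn_integral_mono)
      fix \<omega> assume \<omega>: "\<omega> \<in> space M"
      have "2 * (W \<omega> * (v (\<xi> \<omega>) * (h (\<xi> \<omega>))\<^sup>2)) \<le> (W \<omega> * h (\<xi> \<omega>))\<^sup>2 + (v (\<xi> \<omega>) * h (\<xi> \<omega>))\<^sup>2"
        using zero_le_power2[of "W \<omega> * h (\<xi> \<omega>) - v (\<xi> \<omega>) * h (\<xi> \<omega>)"]
        by (simp add: power2_eq_square algebra_simps)
      then have "ennreal (2 * (W \<omega> * (v (\<xi> \<omega>) * (h (\<xi> \<omega>))\<^sup>2))) \<le>
          ennreal ((W \<omega> * h (\<xi> \<omega>))\<^sup>2 + (v (\<xi> \<omega>) * h (\<xi> \<omega>))\<^sup>2)"
        by (rule ennreal_leI)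
      then show "2 * (ennreal (W \<omega>) * (ennreal (v (\<xi> \<omega>) * (h (\<xi> \<omega>))\<^sup>2) * indicator (B n) (\<xi> \<omega>))) \<le>
          ennreal ((W \<omega> * h (\<xi> \<omega>))\<^sup>2) + ennreal ((v (\<xi> \<omega>) * h (\<xi> \<omega>))\<^sup>2) * indicator (B n) (\<xi> \<omega>)"
        using W_nn[OF \<omega>] v_nn[OF \<xi>_in[OF \<omega>]]
        by (simp add: ennreal_mult ennreal_plus indicator_def)
    qed
    also have "\<dots> = ?W + ?a"
      by (rule nn_integral_add) measurable
    finally show "?a \<le> ?W"
      using a_fin by (auto simp: add.commute[of ?W] ennreal_add_left_cancel_le)
  qed
  have "?V = (\<integral>\<^sup>+\<omega>. (SUP n. ennreal ((v (\<xi> \<omega>) * h (\<xi> \<omega>))\<^sup>2) * indicator (B n) (\<xi> \<omega>)) \<partial>M)"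
  proof (rule nn_integral_cong)
    fix \<omega> assume \<omega>: "\<omega> \<in> space M"
    obtain n where n: "(v (\<xi> \<omega>) * h (\<xi> \<omega>))\<^sup>2 \<le> real n"
      using real_arch_simple by blast
    have "ennreal ((v (\<xi> \<omega>) * h (\<xi> \<omega>))\<^sup>2) \<le> (SUP n. ennreal ((v (\<xi> \<omega>) * h (\<xi> \<omega>))\<^sup>2) * indicator (B n) (\<xi> \<omega>))"
      by (rule SUP_upper2[of n]) (simp_all add: B_def n \<xi>_in[OF \<omega>])
    moreover have "(SUP n. ennreal ((v (\<xi> \<omega>) * h (\<xi> \<omega>))\<^sup>2) * indicator (B n) (\<xi> \<omega>)) \<le> ennreal ((v (\<xi> \<omega>) * h (\<xi> \<omega>))\<^sup>2)"
      by (rule SUP_least) (simp add: indicator_def)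
    ultimately show "ennreal ((v (\<xi> \<omega>) * h (\<xi> \<omega>))\<^sup>2) =
        (SUP n. ennreal ((v (\<xi> \<omega>) * h (\<xi> \<omega>))\<^sup>2) * indicator (B n) (\<xi> \<omega>))"
      by (rule antisym)
  qed
  also have "\<dots> = (SUP n. \<integral>\<^sup>+\<omega>. ennreal ((v (\<xi> \<omega>) * h (\<xi> \<omega>))\<^sup>2) * indicator (B n) (\<xi> \<omega>) \<partial>M)"
  proof (rule nn_integral_monotone_convergence_SUP)
    show "incseq (\<lambda>n \<omega>. ennreal ((v (\<xi> \<omega>) * h (\<xi> \<omega>))\<^sup>2) * indicator (B n) (\<xi> \<omega>))"
      by (auto simp: incseq_def le_fun_def B_def indicator_def)
  qed measurable
  also have "\<dots> \<le> ?W"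
    by (rule SUP_least) (rule trunc)
  finally show ?thesis .
qed

text \<open>Only a finite right-hand side needs an argument. Then both second moments are finite,
  the two means agree by \<open>tower\<close>, and the variances differ exactly by the difference of
  the second moments.\<close>

lemma (in prob_space) ext_variance_tower_le:
  fixes W :: "'a \<Rightarrow> real" and v :: "'c \<Rightarrow> real" and h :: "'c \<Rightarrow> real"
  assumes \<xi> [measurable]: "\<xi> \<in> M \<rightarrow>\<^sub>M S"
    and W [measurable]: "W \<in> borel_measurable M" and v [measurable]: "v \<in> borel_measurable S"
    and h [measurable]: "h \<in> borel_measurable S"
    and W_nn: "\<And>\<omega>. \<omega> \<in> space M \<Longrightarrow> 0 \<le> W \<omega>" and v_nn: "\<And>z. z \<in> space S \<Longrightarrow> 0 \<le> v z"
    and tower: "\<And>g. g \<in> borel_measurable S \<Longrightarrow>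
      (\<integral>\<^sup>+\<omega>. ennreal (W \<omega>) * g (\<xi> \<omega>) \<partial>M) = (\<integral>\<^sup>+\<omega>. ennreal (v (\<xi> \<omega>)) * g (\<xi> \<omega>) \<partial>M)"
  shows "ext_variance M (\<lambda>\<omega>. v (\<xi> \<omega>) * h (\<xi> \<omega>)) \<le> ext_variance M (\<lambda>\<omega>. W \<omega> * h (\<xi> \<omega>))"
proof (cases "ext_variance M (\<lambda>\<omega>. W \<omega> * h (\<xi> \<omega>)) < \<infinity>")
  case True
  let ?W = "\<integral>\<^sup>+\<omega>. ennreal ((W \<omega> * h (\<xi> \<omega>))\<^sup>2) \<partial>M"
  let ?V = "\<integral>\<^sup>+\<omega>. ennreal ((v (\<xi> \<omega>) * h (\<xi> \<omega>))\<^sup>2) \<partial>M"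
  have v_nn': "0 \<le> v (\<xi> \<omega>)" if "\<omega> \<in> space M" for \<omega>
    using that v_nn measurable_space[OF \<xi>] by blast
  have W_fin: "?W < \<infinity>"
    using True by (intro square_integrable_of_ext_variance) measurable
  have le: "?V \<le> ?W"
    using assms by (rule second_moment_tower_le)
  then have V_fin: "?V < \<infinity>"
    using W_fin by (rule le_less_trans)
  \<comment> \<open>\<open>tower\<close> covers nonnegative test functions while \<open>h\<close>
    has a sign. Since \<open>ennreal\<close> cuts negative reals to 0 and both weights are
    nonnegative, the choices \<open>h\<close> and \<open>- h\<close> for \<open>k\<close> yield the
    positive and negative parts from which the Bochner integrals are formed.\<close>
  have part: "(\<integral>\<^sup>+\<omega>. ennreal (W \<omega> * k (\<xi> \<omega>)) \<partial>M) = (\<integral>\<^sup>+\<omega>. ennreal (v (\<xi> \<omega>) * k (\<xi> \<omega>)) \<partial>M)"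
    if k: "k \<in> borel_measurable S" for k :: "'c \<Rightarrow> real"
  proof -
    have "(\<integral>\<^sup>+\<omega>. ennreal (W \<omega>) * ennreal (k (\<xi> \<omega>)) \<partial>M) = (\<integral>\<^sup>+\<omega>. ennreal (v (\<xi> \<omega>)) * ennreal (k (\<xi> \<omega>)) \<partial>M)"
      using k by (intro tower) simp
    then show ?thesis
      using W_nn v_nn' by (simp add: ennreal_mult' cong: nn_integral_cong)
  qed
  have "integrable M (\<lambda>\<omega>. W \<omega> * h (\<xi> \<omega>))" "integrable M (\<lambda>\<omega>. v (\<xi> \<omega>) * h (\<xi> \<omega>))"
    using W_fin V_fin by (intro ext_variance_square_integrable; measurable)+
  then have "(\<integral>\<omega>. W \<omega> * h (\<xi> \<omega>) \<partial>M) = (\<integral>\<omega>. v (\<xi> \<omega>) * h (\<xi> \<omega>) \<partial>M)"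
    using part[OF h] part[of "\<lambda>z. - h z"] by (simp add: real_lebesgue_integral_def)
  moreover have "enn2real ?V \<le> enn2real ?W"
    using le W_fin by (intro enn2real_mono) simp_all
  ultimately show ?thesis
    using W_fin V_fin by (simp add: ext_variance_square_integrable(2) ennreal_leI)
next
  case False
  then show ?thesis
    by (simp add: less_top[symmetric])
qed

section \<open>Laws of sequentially generated trajectories\<close>

lemma trial_density_measurable:
  assumes "trial_density M s k" "s \<le> n"
  shows "(\<lambda>z. k (restrict z {..s - 1}) (z s)) \<in> borel_measurable (Pi\<^sub>M {..n} M)"
proof -
  have k: "(\<lambda>(z, v). k z v) \<in> borel_measurable (Pi\<^sub>M {..s - 1} M \<Otimes>\<^sub>M M s)"
    using assms by (simp add: trial_density_def)
  have "(\<lambda>z. (restrict z {..s - 1}, z s)) \<in> Pi\<^sub>M {..n} M \<rightarrow>\<^sub>M Pi\<^sub>M {..s - 1} M \<Otimes>\<^sub>M M s"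
    using assms(2)
    by (intro measurable_Pair measurable_restrict_subset measurable_component_singleton) auto
  from measurable_comp[OF this k] show ?thesis
    by (simp add: comp_def)
qed

lemma restrict_in_space_PiM:
  "z \<in> space (Pi\<^sub>M J M) \<Longrightarrow> I \<subseteq> J \<Longrightarrow> restrict z I \<in> space (Pi\<^sub>M I M)"
  by (auto simp: space_PiM)

lemma trial_density_nonneg:
  assumes "trial_density M s k" "s \<le> n" "z \<in> space (Pi\<^sub>M {..n} M)"
  shows "0 \<le> k (restrict z {..s - 1}) (z s)"
proof -
  have "restrict z {..s - 1} \<in> space (Pi\<^sub>M {..s - 1} M)"
    using assms(2) by (intro restrict_in_space_PiM[OF assms(3)]) auto
  moreover have "z s \<in> space (M s)"
    using assms(2,3) by (auto simp: space_PiM)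
  ultimately show ?thesis
    using assms(1) by (auto simp: trial_density_def)
qed

lemma restrict_traj: "I \<subseteq> J \<Longrightarrow> restrict (traj J Z \<omega>) I = traj I Z \<omega>"
  by (auto simp: traj_def restrict_def fun_eq_iff)

lemma traj_cong_subset:
  "traj J x \<omega> = traj J x' \<omega> \<Longrightarrow> I \<subseteq> J \<Longrightarrow> traj I x \<omega> = traj I x' \<omega>"
  by (metis restrict_traj)

lemma distributed_cong_variable:
  assumes "\<And>\<omega>. \<omega> \<in> space Q \<Longrightarrow> x \<omega> = x' \<omega>" and "distributed Q S x d"
  shows "distributed Q S x' d"
proof -
  have "distr Q S x = distr Q S x'"
    using assms(1) by (intro distr_cong) simp_all
  moreover have "x \<in> Q \<rightarrow>\<^sub>M S \<longleftrightarrow> x' \<in> Q \<rightarrow>\<^sub>M S"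
    using assms(1) by (intro measurable_cong) simp
  ultimately show ?thesis
    using assms(2) by (simp add: distributed_def)
qed

text \<open>\<open>drawn_from\<close> sees the process only through its trajectory up to
  \<open>s\<close>. This lets the draw of \<open>x2\<close> at time \<open>t\<close> count as a draw
  of \<open>x3\<close>, so that a single process carries the whole law.\<close>

lemma drawn_from_cong_traj:
  assumes eq: "\<And>\<omega>. \<omega> \<in> space Q \<Longrightarrow> traj {..s} x \<omega> = traj {..s} x' \<omega>"
    and "drawn_from Q M s x k"
  shows "drawn_from Q M s x' k"
proof -
  have past: "traj {..s - 1} x \<omega> = traj {..s - 1} x' \<omega>" if "\<omega> \<in> space Q" for \<omega>
    using eq[OF that] by (rule traj_cong_subset) auto
  have "distr Q (Pi\<^sub>M {..s} M) (traj {..s} x) = distr Q (Pi\<^sub>M {..s} M) (traj {..s} x')"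
    using eq by (intro distr_cong) simp_all
  moreover have "traj {..s} x \<in> Q \<rightarrow>\<^sub>M Pi\<^sub>M {..s} M \<longleftrightarrow> traj {..s} x' \<in> Q \<rightarrow>\<^sub>M Pi\<^sub>M {..s} M"
    using eq by (intro measurable_cong) simp
  moreover have "(\<integral>\<^sup>+\<omega>. (\<integral>\<^sup>+v. ennreal (k (traj {..s - 1} x \<omega>) v)
        * indicator A ((traj {..s - 1} x \<omega>)(s := v)) \<partial>M s) \<partial>Q) =
      (\<integral>\<^sup>+\<omega>. (\<integral>\<^sup>+v. ennreal (k (traj {..s - 1} x' \<omega>) v)
        * indicator A ((traj {..s - 1} x' \<omega>)(s := v)) \<partial>M s) \<partial>Q)" for A
    by (intro nn_integral_cong) (simp only: past)
  ultimately show ?thesis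
    using assms(2) by (simp add: drawn_from_def)
qed

text \<open>The integral over \<open>Q\<close> in \<open>drawn_from\<close> depends on the past
  trajectory alone, so it is an integral against \<open>D\<close>; Fubini over the added coordinate
  \<open>s\<close> then fuses \<open>D\<close> and the kernel into one density.\<close>

lemma distributed_drawn_from:
  fixes M :: "nat \<Rightarrow> 'a measure"
  assumes M: "product_sigma_finite M" and s: "0 < s"
    and k: "trial_density M s k"
    and past: "distributed Q (Pi\<^sub>M {..s - 1} M) (traj {..s - 1} x) D"
    and drawn: "drawn_from Q M s x k"
  shows "distributed Q (Pi\<^sub>M {..s} M) (traj {..s} x)
    (\<lambda>z. D (restrict z {..s - 1}) * ennreal (k (restrict z {..s - 1}) (z s)))"
    (is "distributed _ _ _ ?D")
proof -
  interpret product_sigma_finite M by (rule M)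
  have ins: "{..s} = insert s {..s - 1}"
    using s by auto
  have [measurable]: "(\<lambda>z. k (restrict z {..s - 1}) (z s)) \<in> borel_measurable (Pi\<^sub>M {..s} M)"
    using k by (rule trial_density_measurable) simp
  have k' [measurable]: "(\<lambda>(z, v). k z v) \<in> borel_measurable (Pi\<^sub>M {..s - 1} M \<Otimes>\<^sub>M M s)"
    using k by (simp add: trial_density_def)
  have D [measurable]: "D \<in> borel_measurable (Pi\<^sub>M {..s - 1} M)"
    using past by (rule distributed_borel_measurable)
  have [measurable]: "(\<lambda>z. restrict z {..s - 1}) \<in> Pi\<^sub>M {..s} M \<rightarrow>\<^sub>M Pi\<^sub>M {..s - 1} M"
    by (rule measurable_restrict_subset) auto
  have D' [measurable]: "?D \<in> borel_measurable (Pi\<^sub>M {..s} M)"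
    by measurable
  have traj [measurable]: "traj {..s} x \<in> Q \<rightarrow>\<^sub>M Pi\<^sub>M {..s} M"
    using drawn by (simp add: drawn_from_def)
  have upd [measurable]: "(\<lambda>(z, v). z(s := v)) \<in> Pi\<^sub>M {..s - 1} M \<Otimes>\<^sub>M M s \<rightarrow>\<^sub>M Pi\<^sub>M {..s} M"
    unfolding ins by (rule measurable_add_dim)
  have "distr Q (Pi\<^sub>M {..s} M) (traj {..s} x) = density (Pi\<^sub>M {..s} M) ?D"
  proof (rule measure_eqI)
    fix A assume "A \<in> sets (distr Q (Pi\<^sub>M {..s} M) (traj {..s} x))"
    then have A [measurable]: "A \<in> sets (Pi\<^sub>M {..s} M)"
      by simp
    \<comment> \<open>The conditional probability of \<open>A\<close> given the past
      \<open>z\<close>. Both measures of \<open>A\<close> turn out to be its integral against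
      \<open>D\<close>.\<close>
    define g where "g z = (\<integral>\<^sup>+v. ennreal (k z v) * indicator A (z(s := v)) \<partial>M s)" for z
    have kA: "(\<lambda>(z, v). ennreal (k z v) * indicator A (z(s := v))) \<in>
        borel_measurable (Pi\<^sub>M {..s - 1} M \<Otimes>\<^sub>M M s)"
    proof -
      have "(\<lambda>p. indicator A ((fst p)(s := snd p)) :: ennreal) \<in> borel_measurable (Pi\<^sub>M {..s - 1} M \<Otimes>\<^sub>M M s)"
        using measurable_compose[OF upd borel_measurable_indicator[OF A]] by (simp add: case_prod_beta')
      moreover have "(\<lambda>p. ennreal (k (fst p) (snd p))) \<in> borel_measurable (Pi\<^sub>M {..s - 1} M \<Otimes>\<^sub>M M s)"
        using k' by (simp add: case_prod_beta')
      ultimately show ?thesis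
        unfolding case_prod_beta' by (rule borel_measurable_times_ennreal[rotated])
    qed
    have g: "g \<in> borel_measurable (Pi\<^sub>M {..s - 1} M)"
      using sigma_finite_measure.borel_measurable_nn_integral[OF sigma_finite_measures kA]
      by (simp add: g_def[abs_def])
    have "emeasure (density (Pi\<^sub>M {..s} M) ?D) A = (\<integral>\<^sup>+z. ?D z * indicator A z \<partial>Pi\<^sub>M {..s} M)"
      by (rule emeasure_density) measurable
    also have "\<dots> = (\<integral>\<^sup>+z. (\<integral>\<^sup>+v. ?D (z(s := v)) * indicator A (z(s := v)) \<partial>M s) \<partial>Pi\<^sub>M {..s - 1} M)"
      unfolding ins
    proof (rule product_nn_integral_insert)
      have "(\<lambda>z. ?D z * indicator A z) \<in> borel_measurable (Pi\<^sub>M {..s} M)"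
        by measurable
      then show "(\<lambda>z. ?D z * indicator A z) \<in> borel_measurable (Pi\<^sub>M (insert s {..s - 1}) M)"
        by (simp only: ins[symmetric])
    qed (use s in auto)
    also have "\<dots> = (\<integral>\<^sup>+z. D z * g z \<partial>Pi\<^sub>M {..s - 1} M)"
    proof (rule nn_integral_cong)
      fix z assume z: "z \<in> space (Pi\<^sub>M {..s - 1} M)"
      have "restrict (z(s := v)) {..s - 1} = z" for v
        using z s by (auto simp: space_PiM PiE_def extensional_def restrict_def fun_eq_iff)
      then have "(\<integral>\<^sup>+v. ?D (z(s := v)) * indicator A (z(s := v)) \<partial>M s) =
          (\<integral>\<^sup>+v. D z * (ennreal (k z v) * indicator A (z(s := v))) \<partial>M s)"
        by (simp add: mult.assoc)
      also have "\<dots> = D z * g z"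
        unfolding g_def using measurable_compose[OF measurable_Pair1'[OF z] kA]
        by (intro nn_integral_cmult) simp
      finally show "(\<integral>\<^sup>+v. ?D (z(s := v)) * indicator A (z(s := v)) \<partial>M s) = D z * g z" .
    qed
    also have "\<dots> = (\<integral>\<^sup>+\<omega>. g (traj {..s - 1} x \<omega>) \<partial>Q)"
      using past g by (rule distributed_nn_integral)
    also have "\<dots> = emeasure (distr Q (Pi\<^sub>M {..s} M) (traj {..s} x)) A"
      using drawn A by (simp add: drawn_from_def g_def)
    finally show "emeasure (distr Q (Pi\<^sub>M {..s} M) (traj {..s} x)) A =
        emeasure (density (Pi\<^sub>M {..s} M) ?D) A" ..
  qed simp
  with traj D' show ?thesis
    by (simp add: distributed_def)
qed

text \<open>The induction starts at \<open>n = t - 1\<close>, where the product is empty because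
  \<open>t > 0\<close>; each further step multiplies by one kernel. In the base case the two
  densities agree only on the extensional functions of the product space, which suffices for a
  density.\<close>

lemma distributed_sequential:
  fixes M :: "nat \<Rightarrow> 'a measure"
  assumes M: "product_sigma_finite M" and t: "0 < t" and n: "t - 1 \<le> n"
    and start: "distributed Q (Pi\<^sub>M {..t - 1} M) (traj {..t - 1} x) D"
    and k: "\<And>s. s \<in> {t..n} \<Longrightarrow> trial_density M s (k s)"
    and drawn: "\<And>s. s \<in> {t..n} \<Longrightarrow> drawn_from Q M s x (k s)"
  shows "distributed Q (Pi\<^sub>M {..n} M) (traj {..n} x)
    (\<lambda>z. D (restrict z {..t - 1}) * (\<Prod>s = t..n. ennreal (k s (restrict z {..s - 1}) (z s))))"
  using n k drawn
proof (induction n rule: dec_induct)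
  case base
  have eq: "D (restrict z {..t - 1}) * (\<Prod>s = t..t - 1. ennreal (k s (restrict z {..s - 1}) (z s))) = D z"
    (is "?D z = _") if "z \<in> space (Pi\<^sub>M {..t - 1} M)" for z
  proof -
    have "restrict z {..t - 1} = z"
      using that by (auto simp: space_PiM PiE_restrict)
    with t show ?thesis by simp
  qed
  have D: "D \<in> borel_measurable (Pi\<^sub>M {..t - 1} M)"
    using start by (rule distributed_borel_measurable)
  have "?D \<in> borel_measurable (Pi\<^sub>M {..t - 1} M) \<longleftrightarrow> D \<in> borel_measurable (Pi\<^sub>M {..t - 1} M)"
    by (rule measurable_cong) (rule eq)
  then have D': "?D \<in> borel_measurable (Pi\<^sub>M {..t - 1} M)"
    using D by (rule iffD2)
  have "AE z in Pi\<^sub>M {..t - 1} M. ?D z = D z"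
    by (rule AE_I2) (rule eq)
  from distributed_cong_density[OF this D D'] start show ?case
    by (rule iffD2)
next
  case (step n)
  let ?D = "\<lambda>z. D (restrict z {..t - 1}) * (\<Prod>s = t..n. ennreal (k s (restrict z {..s - 1}) (z s)))"
  have Suc: "Suc n \<in> {t..Suc n}"
    using step.hyps t by auto
  have "distributed Q (Pi\<^sub>M {..n} M) (traj {..n} x) ?D"
    by (rule step.IH) (use step.prems in auto)
  then have "distributed Q (Pi\<^sub>M {..Suc n - 1} M) (traj {..Suc n - 1} x) ?D"
    by (simp only: diff_Suc_1)
  from distributed_drawn_from[OF M zero_less_Suc step.prems(1)[OF Suc] this step.prems(2)[OF Suc]]
  have "distributed Q (Pi\<^sub>M {..Suc n} M) (traj {..Suc n} x)
      (\<lambda>z. ?D (restrict z {..n}) * ennreal (k (Suc n) (restrict z {..n}) (z (Suc n))))"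
    by (simp only: diff_Suc_1)
  moreover have "?D (restrict z {..n}) * ennreal (k (Suc n) (restrict z {..n}) (z (Suc n))) =
      D (restrict z {..t - 1}) * (\<Prod>s = t..Suc n. ennreal (k s (restrict z {..s - 1}) (z s)))" for z
  proof -
    have sub: "restrict (restrict z {..n}) {..s} = restrict z {..s}" if "s \<le> n" for s
      using that by (auto simp: restrict_def fun_eq_iff)
    have "(\<Prod>s = t..n. ennreal (k s (restrict (restrict z {..n}) {..s - 1}) (restrict z {..n} s))) =
        (\<Prod>s = t..n. ennreal (k s (restrict z {..s - 1}) (z s)))"
    proof (rule prod.cong)
      fix s assume "s \<in> {t..n}"
      then have "s \<le> n" "s - 1 \<le> n" by auto
      then show "ennreal (k s (restrict (restrict z {..n}) {..s - 1}) (restrict z {..n} s)) =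
          ennreal (k s (restrict z {..s - 1}) (z s))"
        by (simp only: sub restrict_apply' atMost_iff)
    qed simp
    moreover have "t \<le> Suc n" using Suc by simp
    ultimately show ?thesis
      by (simp only: sub[OF step.hyps(1)] prod.nat_ivl_Suc' diff_Suc_1 ac_simps)
  qed
  ultimately show ?case by (simp only:)
qed

section \<open>Posterior densities at a fixed observation\<close>

lemma joint_density_section_measurable:
  assumes "latent_model P M N X Y f" and y: "y \<in> space (Pi\<^sub>M {1..T} N)"
  shows "(\<lambda>x. f T (x, y)) \<in> borel_measurable (Pi\<^sub>M {..T} M)"
proof -
  interpret latent_model P M N X Y f by fact
  have "f T \<in> borel_measurable (Pi\<^sub>M {..T} M \<Otimes>\<^sub>M Pi\<^sub>M {1..T} N)"
    using joint_density by (rule distributed_borel_measurable)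
  from measurable_compose[OF measurable_Pair2'[OF y] this] show ?thesis .
qed

lemma latent_model_product_sigma_finite:
  assumes "latent_model P M N X Y f"
  shows "product_sigma_finite M"
  using assms by (simp add: latent_model_def latent_model_axioms_def product_sigma_finite_def)

text \<open>For \<open>s \<le> T\<close> the horizon is \<open>T\<close> itself, so no observation
  is left to integrate out: the inner integral runs over the empty product, a single point of mass
  1.\<close>

lemma joint_dens_eq:
  assumes s: "s \<le> T" and y: "y \<in> space (Pi\<^sub>M {1..T} N)"
  shows "joint_dens M N f T s y x = (\<integral>\<^sup>+u. f T (merge {..s} {s<..T} (x, u), y) \<partial>Pi\<^sub>M {s<..T} M)"
proof -
  have "merge {1..T} {} (y, v) = y" for v
    using y by (auto simp: merge_def space_PiM PiE_def extensional_def fun_eq_iff)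
  then show ?thesis
    using s by (simp add: joint_dens_def max_absorb2 PiM_empty nn_integral_count_space_finite)
qed

lemma joint_dens_same_horizon:
  assumes y: "y \<in> space (Pi\<^sub>M {1..T} N)" and x: "x \<in> space (Pi\<^sub>M {..T} M)"
  shows "joint_dens M N f T T y x = f T (x, y)"
proof -
  have "merge {..T} {} (x, u) = x" for u
    using x by (auto simp: merge_def space_PiM PiE_def extensional_def fun_eq_iff)
  then show ?thesis
    using y by (simp add: joint_dens_eq PiM_empty nn_integral_count_space_finite)
qed

lemma joint_dens_measurable:
  assumes model: "latent_model P M N X Y f" and s: "s \<le> T" and y: "y \<in> space (Pi\<^sub>M {1..T} N)"
  shows "joint_dens M N f T s y \<in> borel_measurable (Pi\<^sub>M {..s} M)"
proof -
  interpret product_sigma_finite M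
    using model by (rule latent_model_product_sigma_finite)
  interpret fin: finite_product_sigma_finite M "{s<..T}"
    by standard simp
  have Un: "{..s} \<union> {s<..T} = {..T}"
    using s by auto
  have "(\<lambda>p. f T (merge {..s} {s<..T} p, y)) \<in> borel_measurable (Pi\<^sub>M {..s} M \<Otimes>\<^sub>M Pi\<^sub>M {s<..T} M)"
    using measurable_compose[OF measurable_merge[of "{..s}" "{s<..T}" M, unfolded Un] joint_density_section_measurable[OF model y]] .
  then have "(\<lambda>x. \<integral>\<^sup>+u. f T (merge {..s} {s<..T} (x, u), y) \<partial>Pi\<^sub>M {s<..T} M) \<in> borel_measurable (Pi\<^sub>M {..s} M)"
    by (rule fin.borel_measurable_nn_integral_fst)
  then show ?thesis
    unfolding joint_dens_eq[OF s y, abs_def] .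
qed

lemma post_measurable:
  assumes "latent_model P M N X Y f" and "s \<le> T" and "y \<in> space (Pi\<^sub>M {1..T} N)"
  shows "post M N f T s y \<in> borel_measurable (Pi\<^sub>M {..s} M)"
proof -
  have [measurable]: "joint_dens M N f T s y \<in> borel_measurable (Pi\<^sub>M {..s} M)"
    using assms by (rule joint_dens_measurable)
  show ?thesis
    unfolding post_def by measurable
qed

text \<open>Fubini along the split of the coordinates at \<open>s\<close>: the test function does
  not see the coordinates after \<open>s\<close>, so the inner integral acts on the density only.
  This is the step that removes the future states.\<close>

lemma joint_dens_marginal:
  assumes model: "latent_model P M N X Y f" and s: "s \<le> T" and y: "y \<in> space (Pi\<^sub>M {1..T} N)"
    and g: "g \<in> borel_measurable (Pi\<^sub>M {..s} M)"
  shows "(\<integral>\<^sup>+z. joint_dens M N f T T y z * g (restrict z {..s}) \<partial>Pi\<^sub>M {..T} M) =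
    (\<integral>\<^sup>+z. joint_dens M N f T s y z * g z \<partial>Pi\<^sub>M {..s} M)"
proof -
  interpret product_sigma_finite M
    using model by (rule latent_model_product_sigma_finite)
  have Un: "{..s} \<union> {s<..T} = {..T}"
    using s by auto
  have F [measurable]: "(\<lambda>x. f T (x, y)) \<in> borel_measurable (Pi\<^sub>M {..T} M)"
    using model y by (rule joint_density_section_measurable)
  have [measurable]: "(\<lambda>z. g (restrict z {..s})) \<in> borel_measurable (Pi\<^sub>M {..T} M)"
    by (rule measurable_compose[OF measurable_restrict_subset g]) (use s in auto)
  have "(\<integral>\<^sup>+z. joint_dens M N f T T y z * g (restrict z {..s}) \<partial>Pi\<^sub>M {..T} M) =
      (\<integral>\<^sup>+z. f T (z, y) * g (restrict z {..s}) \<partial>Pi\<^sub>M {..T} M)"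
    using y by (intro nn_integral_cong) (simp add: joint_dens_same_horizon)
  also have "\<dots> = (\<integral>\<^sup>+z. (\<integral>\<^sup>+u. f T (merge {..s} {s<..T} (z, u), y) *
      g (restrict (merge {..s} {s<..T} (z, u)) {..s}) \<partial>Pi\<^sub>M {s<..T} M) \<partial>Pi\<^sub>M {..s} M)"
    unfolding Un[symmetric] by (rule product_nn_integral_fold) (simp_all add: Un, auto)
  also have "\<dots> = (\<integral>\<^sup>+z. joint_dens M N f T s y z * g z \<partial>Pi\<^sub>M {..s} M)"
  proof (rule nn_integral_cong)
    fix z assume z: "z \<in> space (Pi\<^sub>M {..s} M)"
    have "restrict (merge {..s} {s<..T} (z, u)) {..s} = z" for u
      using z by (auto simp: merge_def space_PiM PiE_def extensional_def fun_eq_iff)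
    moreover have "(\<lambda>u. f T (merge {..s} {s<..T} (z, u), y)) \<in> borel_measurable (Pi\<^sub>M {s<..T} M)"
      using measurable_compose[OF measurable_compose[OF measurable_Pair1'[OF z]
        measurable_merge[of "{..s}" "{s<..T}" M, unfolded Un]] F] .
    ultimately show "(\<integral>\<^sup>+u. f T (merge {..s} {s<..T} (z, u), y) *
        g (restrict (merge {..s} {s<..T} (z, u)) {..s}) \<partial>Pi\<^sub>M {s<..T} M) = joint_dens M N f T s y z * g z"
      by (simp add: nn_integral_multc joint_dens_eq[OF s y])
  qed
  finally show ?thesis .
qed

lemma nn_integral_joint_dens:
  assumes "latent_model P M N X Y f" and "s \<le> T" and "y \<in> space (Pi\<^sub>M {1..T} N)"
  shows "(\<integral>\<^sup>+z. joint_dens M N f T s y z \<partial>Pi\<^sub>M {..s} M) = obs_dens M N f T y"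
  using joint_dens_marginal[OF assms, of "\<lambda>_. 1"] by (simp add: obs_dens_def)

lemma AE_joint_dens_finite:
  assumes "latent_model P M N X Y f" and "s \<le> T" and "y \<in> space (Pi\<^sub>M {1..T} N)"
    and "obs_dens M N f T y < \<infinity>"
  shows "AE z in Pi\<^sub>M {..s} M. joint_dens M N f T s y z < \<infinity>"
  using nn_integral_PInf_AE[OF joint_dens_measurable[OF assms(1-3)]] assms(4)
  by (simp add: nn_integral_joint_dens[OF assms(1-3)] less_top)

text \<open>\<open>enn2real\<close> loses the value \<infinity>, so the quotient is recovered only
  where the joint density is finite. That is almost everywhere, since its total integral
  \<open>obs_dens\<close> is finite.\<close>

lemma AE_ennreal_post:
  assumes "latent_model P M N X Y f" and "s \<le> T" and "y \<in> space (Pi\<^sub>M {1..T} N)"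
    and "0 < obs_dens M N f T y" and "obs_dens M N f T y < \<infinity>"
  shows "AE z in Pi\<^sub>M {..s} M.
    ennreal (post M N f T s y z) = joint_dens M N f T s y z / obs_dens M N f T y"
  using AE_joint_dens_finite[OF assms(1-3,5)]
proof eventually_elim
  case (elim z)
  then have "joint_dens M N f T s y z / obs_dens M N f T y < top"
    using assms(4) by (auto simp: ennreal_divide_eq_top_iff less_top[symmetric])
  then show ?case
    by (simp add: post_def)
qed

text \<open>A cylinder over a null set is null, by Fubini. Needed because statements about a
  marginal density must be read on the longer trajectory space.\<close>

lemma AE_restrict_PiM:
  assumes M: "product_sigma_finite M" and I: "I \<subseteq> J" "finite J"
    and "AE z in Pi\<^sub>M I M. R z"
  shows "AE z in Pi\<^sub>M J M. R (restrict z I)"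
proof -
  interpret product_sigma_finite M by (rule M)
  have Un: "I \<union> (J - I) = J" using I by auto
  have fin: "finite I" "finite (J - I)" using I finite_subset by auto
  obtain A where A: "A \<in> sets (Pi\<^sub>M I M)" "emeasure (Pi\<^sub>M I M) A = 0"
      "{z \<in> space (Pi\<^sub>M I M). \<not> R z} \<subseteq> A"
    using AE_E[OF assms(4)] by metis
  have ind: "(\<lambda>z. indicator A (restrict z I) :: ennreal) \<in> borel_measurable (Pi\<^sub>M J M)"
    using A(1) I(1) by (intro measurable_compose[OF measurable_restrict_subset borel_measurable_indicator])
  have "(\<integral>\<^sup>+z. indicator A (restrict z I) \<partial>Pi\<^sub>M J M) =
      (\<integral>\<^sup>+z. (\<integral>\<^sup>+u. indicator A (restrict (merge I (J - I) (z, u)) I) \<partial>Pi\<^sub>M (J - I) M) \<partial>Pi\<^sub>M I M)"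
    by (rule product_nn_integral_fold[of I "J - I", unfolded Un, OF _ fin ind]) simp
  also have "\<dots> = (\<integral>\<^sup>+z. indicator A z * emeasure (Pi\<^sub>M (J - I) M) (space (Pi\<^sub>M (J - I) M)) \<partial>Pi\<^sub>M I M)"
  proof (rule nn_integral_cong)
    fix z assume z: "z \<in> space (Pi\<^sub>M I M)"
    have "restrict (merge I (J - I) (z, u)) I = z" for u
      using z by (auto simp: merge_def space_PiM PiE_def extensional_def fun_eq_iff)
    then show "(\<integral>\<^sup>+u. indicator A (restrict (merge I (J - I) (z, u)) I) \<partial>Pi\<^sub>M (J - I) M) =
        indicator A z * emeasure (Pi\<^sub>M (J - I) M) (space (Pi\<^sub>M (J - I) M))"
      by simp
  qed
  \<comment> \<open>The product over the remaining coordinates may have infinite mass; in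
    \<open>ennreal\<close> a zero factor still gives 0.\<close>
  also have "\<dots> = 0"
    using A by (simp add: nn_integral_multc)
  finally have "AE z in Pi\<^sub>M J M. indicator A (restrict z I) = (0 :: ennreal)"
    using nn_integral_0_iff_AE[OF ind] by simp
  then show ?thesis
  proof (rule AE_mp, intro AE_I2 impI)
    fix z assume z: "z \<in> space (Pi\<^sub>M J M)" and "indicator A (restrict z I) = (0 :: ennreal)"
    then show "R (restrict z I)"
      using restrict_in_space_PiM[OF z I(1)] A(3) by (auto simp: indicator_def split: if_splits)
  qed
qed

text \<open>The marginal is the denominator of \<open>post_cond\<close>. Where it vanished,
  \<open>post_cond\<close> would be 0 by default and a support condition would say nothing about a
  positive numerator; such points form a null set.\<close>

lemma AE_post_marginal_pos:
  assumes model: "latent_model P M N X Y f" and s: "s \<le> T" and y: "y \<in> space (Pi\<^sub>M {1..T} N)"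
    and C: "0 < obs_dens M N f T y" "obs_dens M N f T y < \<infinity>"
  shows "AE z in Pi\<^sub>M {..T} M. 0 < post M N f T T y z \<longrightarrow> 0 < post M N f T s y (restrict z {..s})"
proof -
  have M: "product_sigma_finite M"
    using model by (rule latent_model_product_sigma_finite)
  have J [measurable]: "joint_dens M N f T s y \<in> borel_measurable (Pi\<^sub>M {..s} M)"
    using model s y by (rule joint_dens_measurable)
  have JT [measurable]: "joint_dens M N f T T y \<in> borel_measurable (Pi\<^sub>M {..T} M)"
    using model order_refl y by (rule joint_dens_measurable)
  \<comment> \<open>The indicator of the zeros of the marginal. Tested against it, the marginal
    integrates to 0, hence so does the full density.\<close>
  define g where "g z = (if joint_dens M N f T s y z = 0 then 1 else 0 :: ennreal)" for z
  have g [measurable]: "g \<in> borel_measurable (Pi\<^sub>M {..s} M)"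
    unfolding g_def by measurable
  have [measurable]: "(\<lambda>z. g (restrict z {..s})) \<in> borel_measurable (Pi\<^sub>M {..T} M)"
    by (rule measurable_compose[OF measurable_restrict_subset g]) (use s in auto)
  have "(\<integral>\<^sup>+z. joint_dens M N f T T y z * g (restrict z {..s}) \<partial>Pi\<^sub>M {..T} M) =
      (\<integral>\<^sup>+z. joint_dens M N f T s y z * g z \<partial>Pi\<^sub>M {..s} M)"
    using model s y g by (rule joint_dens_marginal)
  also have "\<dots> = (\<integral>\<^sup>+z. 0 \<partial>Pi\<^sub>M {..s} M)"
    by (intro nn_integral_cong) (simp add: g_def)
  finally have "(\<integral>\<^sup>+z. joint_dens M N f T T y z * g (restrict z {..s}) \<partial>Pi\<^sub>M {..T} M) = 0"
    by simp
  then have "AE z in Pi\<^sub>M {..T} M. joint_dens M N f T T y z * g (restrict z {..s}) = 0"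
    by (rule nn_integral_0_iff_AE[THEN iffD1, rotated]) measurable
  \<comment> \<open>Finiteness matters because an infinite marginal density would be turned into
    posterior value 0 by \<open>enn2real\<close>.\<close>
  moreover have "AE z in Pi\<^sub>M {..T} M. joint_dens M N f T s y (restrict z {..s}) < \<infinity>"
    using AE_joint_dens_finite[OF model s y C(2)] s by (intro AE_restrict_PiM[OF M]) auto
  ultimately show ?thesis
  proof eventually_elim
    case (elim z)
    show ?case
    proof
      assume "0 < post M N f T T y z"
      then have "joint_dens M N f T T y z \<noteq> 0"
        by (auto simp: post_def)
      then have "joint_dens M N f T s y (restrict z {..s}) \<noteq> 0"
        using elim(1) by (auto simp: g_def)
      with elim(2) C show "0 < post M N f T s y (restrict z {..s})"
        by (simp add: post_def enn2real_positive_iff ennreal_zero_less_divide zero_less_iff_neq_zero less_top[symmetric]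
            ennreal_divide_eq_top_iff)
    qed
  qed
qed

text \<open>Here \<open>r * k\<close> is the density of the proposal, \<open>p / r\<close> the
  incoming weight and \<open>m / (p * k)\<close> its update. If any of \<open>p\<close>,
  \<open>r\<close>, \<open>k\<close> is 0, division by zero makes the product 0 instead of
  \<open>m\<close>.\<close>

lemma importance_weight_cancel:
  fixes r p k m :: real
  shows "r * k * (p / r * (m / (p * k))) = (if p \<noteq> 0 \<and> r \<noteq> 0 \<and> k \<noteq> 0 then m else 0)"
  by simp

section \<open>Lookahead weighting\<close>

theorem proposition3:
  fixes P :: "'p measure" and Q :: "'w measure"
    and M :: "nat \<Rightarrow> 'a measure" and N :: "nat \<Rightarrow> 'b measure"
    and X :: "nat \<Rightarrow> 'p \<Rightarrow> 'a" and Y :: "nat \<Rightarrow> 'p \<Rightarrow> 'b"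
    and f :: "nat \<Rightarrow> (nat \<Rightarrow> 'a) \<times> (nat \<Rightarrow> 'b) \<Rightarrow> ennreal"
    and t \<Delta> j :: nat
    and y :: "nat \<Rightarrow> 'b"
    and q :: "nat \<Rightarrow> (nat \<Rightarrow> 'b) \<Rightarrow> (nat \<Rightarrow> 'a) \<Rightarrow> 'a \<Rightarrow> real"
    and x1 x2 x3 :: "nat \<Rightarrow> nat \<Rightarrow> 'w \<Rightarrow> 'a"
    and w1 w2 w3 :: "nat \<Rightarrow> 'w \<Rightarrow> real"
  assumes model: "latent_model P M N X Y f"
    and t: "t \<ge> 1"
    and y: "y \<in> space (Pi\<^sub>M {1..t + \<Delta>} N)"
           "0 < obs_dens M N f (t + \<Delta>) y" "obs_dens M N f (t + \<Delta>) y < \<infinity>"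
    and Q: "prob_space Q"
    and proper: "properly_weighted Q (Pi\<^sub>M {..t - 1} M) (traj {..t - 1} (x1 j)) (w1 j)
                   (post M N f (t - 1) (t - 1) (restrict y {1..t - 1}))"
    and q_density: "\<And>s. s \<in> {t..t + \<Delta>} \<Longrightarrow> trial_density M s (q s y)"
    and q_t: "no_lookahead N t (t + \<Delta>) (q t)"
    and cover_t: "supp_covers (Pi\<^sub>M {..t} M) (\<lambda>z. q t y (restrict z {..t - 1}) (z t))
                    (post_cond M N f (t + \<Delta>) (t - 1) t y)"
    and cover_future: "supp_covers (Pi\<^sub>M {..t + \<Delta>} M)
                    (\<lambda>z. \<Prod>s = t + 1..t + \<Delta>. q s y (restrict z {..s - 1}) (z s))
                    (post_cond M N f (t + \<Delta>) t (t + \<Delta>) y)"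
    and x2_past: "\<And>\<omega>. \<omega> \<in> space Q \<Longrightarrow> traj {..t - 1} (x2 j) \<omega> = traj {..t - 1} (x1 j) \<omega>"
    and x2_drawn: "drawn_from Q M t (x2 j) (q t y)"
    and w2: "\<And>\<omega>. \<omega> \<in> space Q \<Longrightarrow> w2 j \<omega> =
               w1 j \<omega> * (post M N f (t + \<Delta>) t y (traj {..t} (x2 j) \<omega>) /
                 (post M N f (t - 1) (t - 1) (restrict y {1..t - 1}) (traj {..t - 1} (x1 j) \<omega>)
                   * q t y (traj {..t - 1} (x1 j) \<omega>) (x2 j t \<omega>)))"
    and x3_past: "\<And>\<omega>. \<omega> \<in> space Q \<Longrightarrow> traj {..t} (x3 j) \<omega> = traj {..t} (x2 j) \<omega>"
    and x3_drawn: "\<And>s. s \<in> {t + 1..t + \<Delta>} \<Longrightarrow> drawn_from Q M s (x3 j) (q s y)"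
    and w3: "\<And>\<omega>. \<omega> \<in> space Q \<Longrightarrow> w3 j \<omega> =
               w1 j \<omega> * (post M N f (t + \<Delta>) (t + \<Delta>) y (traj {..t + \<Delta>} (x3 j) \<omega>) /
                 (post M N f (t - 1) (t - 1) (restrict y {1..t - 1}) (traj {..t - 1} (x1 j) \<omega>)
                   * (\<Prod>s = t..t + \<Delta>. q s y (traj {..s - 1} (x3 j) \<omega>) (x3 j s \<omega>))))"
  shows "ext_variance Q (w3 j) \<ge> ext_variance Q (w2 j) \<and>
         (\<forall>h :: (nat \<Rightarrow> 'a) \<Rightarrow> real.
            h \<in> borel_measurable (Pi\<^sub>M {..t} M) \<and>
            (\<integral>\<^sup>+z. ennreal ((h z)\<^sup>2 * post M N f (t + \<Delta>) t y z) \<partial>Pi\<^sub>M {..t} M) < \<infinity> \<longrightarrow>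
            ext_variance Q (\<lambda>\<omega>. w3 j \<omega> * h (traj {..t} (x2 j) \<omega>))
              \<ge> ext_variance Q (\<lambda>\<omega>. w2 j \<omega> * h (traj {..t} (x2 j) \<omega>)))"
proof -
  interpret Q: prob_space Q by (rule Q)
  have M: "product_sigma_finite M"
    using model by (rule latent_model_product_sigma_finite)
  define T where "T = t + \<Delta>"
  define C where "C = obs_dens M N f T y"
  define past where "past z = restrict z {..t - 1}" for z :: "nat \<Rightarrow> 'a"
  define p where "p = post M N f (t - 1) (t - 1) (restrict y {1..t - 1})"
  define qt where "qt z = q t y (restrict z {..t - 1}) (z t)" for z
  define qs where "qs n z = (\<Prod>s = t..n. q s y (restrict z {..s - 1}) (z s))" for n z
  note y' = y[folded T_def]
  have tT: "t \<le> T" and t0: "0 < t" and tt: "t \<in> {t..T}"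
    using t by (simp_all add: T_def)

  from proper obtain r where
    r_nn: "\<And>z. z \<in> space (Pi\<^sub>M {..t - 1} M) \<Longrightarrow> 0 \<le> r z" and
    r_dist: "distributed Q (Pi\<^sub>M {..t - 1} M) (traj {..t - 1} (x1 j)) (\<lambda>z. ennreal (r z))" and
    w1: "\<And>\<omega>. \<omega> \<in> space Q \<Longrightarrow> w1 j \<omega> = p (traj {..t - 1} (x1 j) \<omega>) / r (traj {..t - 1} (x1 j) \<omega>)"
    unfolding properly_weighted_def p_def by blast
  \<comment> \<open>One formula for both weights: \<open>n = t\<close> with the marginal posterior
    gives \<open>w2\<close>, and \<open>n = T\<close> with the full posterior gives
    \<open>w3\<close>.\<close>
  define wt where "wt n m z = p (past z) / r (past z) * (m z / (p (past z) * qs n z))"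
    for n and m z

  have x12: "traj {..t - 1} (x1 j) \<omega> = traj {..t - 1} (x3 j) \<omega>" if "\<omega> \<in> space Q" for \<omega>
  proof -
    have "traj {..t - 1} (x3 j) \<omega> = traj {..t - 1} (x2 j) \<omega>"
      using x3_past[OF that] by (rule traj_cong_subset) auto
    then show ?thesis
      using x2_past[OF that] by simp
  qed
  have q_dens: "trial_density M s (q s y)" if "s \<in> {t..T}" for s
    using q_density that by (simp add: T_def)
  \<comment> \<open>The draw at time \<open>t\<close> is known for \<open>x2\<close> and is
    transferred; the later ones are given for \<open>x3\<close>.\<close>
  have q_drawn: "drawn_from Q M s (x3 j) (q s y)" if "s \<in> {t..T}" for s
  proof (cases "s = t")
    case True
    then show ?thesis
      using drawn_from_cong_traj[OF x3_past[symmetric] x2_drawn] by simp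
  next
    case False
    then show ?thesis
      using that by (intro x3_drawn) (auto simp: T_def)
  qed
  have law: "distributed Q (Pi\<^sub>M {..n} M) (traj {..n} (x3 j)) (\<lambda>z. ennreal (r (past z)) *
      (\<Prod>s = t..n. ennreal (q s y (restrict z {..s - 1}) (z s))))" if "t \<le> n" "n \<le> T" for n
    unfolding past_def
    using that q_dens q_drawn
    by (intro distributed_sequential[where D = "\<lambda>z. ennreal (r z)" and k = "\<lambda>s. q s y", OF M t0]
        distributed_cong_variable[OF x12 r_dist]) auto

  have past_in: "past z \<in> space (Pi\<^sub>M {..t - 1} M)" if "z \<in> space (Pi\<^sub>M {..n} M)" "t \<le> n" for z n
    unfolding past_def using that by (intro restrict_in_space_PiM[OF that(1)]) auto
  have past_meas: "past \<in> Pi\<^sub>M {..n} M \<rightarrow>\<^sub>M Pi\<^sub>M {..t - 1} M" if "t \<le> n" for n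
    unfolding past_def using that by (intro measurable_restrict_subset) auto
  have q_nn: "0 \<le> q s y (restrict z {..s - 1}) (z s)"
    if "z \<in> space (Pi\<^sub>M {..n} M)" "s \<in> {t..n}" "n \<le> T" for z s n
    using that by (intro trial_density_nonneg[OF q_dens, of s n]) auto
  have qs_nn: "0 \<le> qs n z" if "z \<in> space (Pi\<^sub>M {..n} M)" "n \<le> T" for z n
    unfolding qs_def using that by (intro prod_nonneg) (blast intro: q_nn)
  have qs_meas: "qs n \<in> borel_measurable (Pi\<^sub>M {..n} M)" if "n \<le> T" for n
    unfolding qs_def[abs_def] using that
    by (intro borel_measurable_prod trial_density_measurable q_dens) auto
  have p_nn: "0 \<le> p z" for z
    by (simp add: p_def post_def)
  have p_meas: "p \<in> borel_measurable (Pi\<^sub>M {..t - 1} M)"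
    unfolding p_def
    by (rule post_measurable[OF model order_refl restrict_in_space_PiM[OF y'(1)]]) (auto simp: T_def)
  \<comment> \<open>\<open>distributed\<close> yields measurability of \<open>ennreal\<close>
    applied to \<open>r\<close>; nonnegativity on the space recovers \<open>r\<close>
    itself.\<close>
  have r_meas: "r \<in> borel_measurable (Pi\<^sub>M {..t - 1} M)"
  proof -
    have "(\<lambda>z. enn2real (ennreal (r z))) \<in> borel_measurable (Pi\<^sub>M {..t - 1} M)"
      using distributed_borel_measurable[OF r_dist] by measurable
    moreover have "(\<lambda>z. enn2real (ennreal (r z))) \<in> borel_measurable (Pi\<^sub>M {..t - 1} M) \<longleftrightarrow>
        r \<in> borel_measurable (Pi\<^sub>M {..t - 1} M)"
      by (intro measurable_cong enn2real_ennreal r_nn)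
    ultimately show ?thesis by blast
  qed
  have wt_meas: "wt n m \<in> borel_measurable (Pi\<^sub>M {..n} M)"
    if "t \<le> n" "n \<le> T" "m \<in> borel_measurable (Pi\<^sub>M {..n} M)" for n m
    unfolding wt_def[abs_def]
    using that(3) qs_meas[OF that(2)] measurable_compose[OF past_meas[OF that(1)] p_meas]
      measurable_compose[OF past_meas[OF that(1)] r_meas]
    by measurable
  have wt_nn: "0 \<le> wt n m z" if "z \<in> space (Pi\<^sub>M {..n} M)" "t \<le> n" "n \<le> T" "0 \<le> m z" for n m z
    unfolding wt_def using that qs_nn[of z n] p_nn r_nn[OF past_in[of z n]] by simp

  \<comment> \<open>Passing from \<open>Q\<close> to the reference measure brings in the proposal
    density, which cancels inside the weight; the target \<open>m\<close> and the indicator of the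
    points without a zero factor remain.\<close>
  have integral_wt: "(\<integral>\<^sup>+\<omega>. ennreal (wt n m (traj {..n} (x3 j) \<omega>)) * g (traj {..n} (x3 j) \<omega>) \<partial>Q) =
      (\<integral>\<^sup>+z. ennreal (m z) * ((if p (past z) \<noteq> 0 \<and> r (past z) \<noteq> 0 \<and> qs n z \<noteq> 0 then 1 else 0) * g z) \<partial>Pi\<^sub>M {..n} M)"
    if n: "t \<le> n" "n \<le> T" and m: "m \<in> borel_measurable (Pi\<^sub>M {..n} M)" and m_nn: "\<And>z. 0 \<le> m z"
      and g: "g \<in> borel_measurable (Pi\<^sub>M {..n} M)" for n m g
  proof -
    have [measurable]: "wt n m \<in> borel_measurable (Pi\<^sub>M {..n} M)"
      using n m by (rule wt_meas)
    have "(\<integral>\<^sup>+\<omega>. ennreal (wt n m (traj {..n} (x3 j) \<omega>)) * g (traj {..n} (x3 j) \<omega>) \<partial>Q) =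
      (\<integral>\<^sup>+z. (ennreal (r (past z)) * (\<Prod>s = t..n. ennreal (q s y (restrict z {..s - 1}) (z s)))) *
        (ennreal (wt n m z) * g z) \<partial>Pi\<^sub>M {..n} M)"
      by (rule distributed_nn_integral[OF law[OF n], symmetric]) (use g in measurable)
    also have "\<dots> = (\<integral>\<^sup>+z. ennreal (m z) *
        ((if p (past z) \<noteq> 0 \<and> r (past z) \<noteq> 0 \<and> qs n z \<noteq> 0 then 1 else 0) * g z) \<partial>Pi\<^sub>M {..n} M)"
    proof (rule nn_integral_cong)
      fix z assume z: "z \<in> space (Pi\<^sub>M {..n} M)"
      have "(\<Prod>s = t..n. ennreal (q s y (restrict z {..s - 1}) (z s))) = ennreal (qs n z)"
        unfolding qs_def using q_nn[OF z _ n(2)] by (rule prod_ennreal)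
      moreover have "ennreal (r (past z)) * ennreal (qs n z) * ennreal (wt n m z) =
          ennreal (r (past z) * qs n z * wt n m z)"
        using r_nn[OF past_in[OF z n(1)]] qs_nn[OF z n(2)] wt_nn[OF z n m_nn]
        by (simp add: ennreal_mult)
      moreover have "\<dots> = ennreal (m z) *
          (if p (past z) \<noteq> 0 \<and> r (past z) \<noteq> 0 \<and> qs n z \<noteq> 0 then 1 else 0)"
        unfolding wt_def importance_weight_cancel by simp
      ultimately show "(ennreal (r (past z)) * (\<Prod>s = t..n. ennreal (q s y (restrict z {..s - 1}) (z s)))) *
          (ennreal (wt n m z) * g z) = ennreal (m z) *
          ((if p (past z) \<noteq> 0 \<and> r (past z) \<noteq> 0 \<and> qs n z \<noteq> 0 then 1 else 0) * g z)"
        by (simp only: mult.assoc[symmetric])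
    qed
    finally show ?thesis .
  qed

  define W where "W = wt T (post M N f T T y)"
  define v where "v = wt t (post M N f T t y)"
  have post_nn: "0 \<le> post M N f a b y z" for a b z
    by (simp add: post_def)
  have postT_meas: "post M N f T T y \<in> borel_measurable (Pi\<^sub>M {..T} M)"
    using model order_refl y'(1) by (rule post_measurable)
  have postt_meas: "post M N f T t y \<in> borel_measurable (Pi\<^sub>M {..t} M)"
    using model tT y'(1) by (rule post_measurable)
  have W_meas: "W \<in> borel_measurable (Pi\<^sub>M {..T} M)"
    unfolding W_def using tT order_refl postT_meas by (rule wt_meas)
  have v_meas: "v \<in> borel_measurable (Pi\<^sub>M {..t} M)"
    unfolding v_def using order_refl tT postt_meas by (rule wt_meas)
  have trajT: "traj {..T} (x3 j) \<in> Q \<rightarrow>\<^sub>M Pi\<^sub>M {..T} M"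
    using law[OF tT order_refl] by (rule distributed_measurable)
  have trajt: "traj {..t} (x3 j) \<in> Q \<rightarrow>\<^sub>M Pi\<^sub>M {..t} M"
    using law[OF order_refl tT] by (rule distributed_measurable)

  have qs_traj: "qs n (traj {..n} (x3 j) \<omega>) = (\<Prod>s = t..n. q s y (traj {..s - 1} (x3 j) \<omega>) (x3 j s \<omega>))"
    for n \<omega>
    unfolding qs_def
  proof (rule prod.cong)
    fix s assume "s \<in> {t..n}"
    then show "q s y (restrict (traj {..n} (x3 j) \<omega>) {..s - 1}) (traj {..n} (x3 j) \<omega> s) =
        q s y (traj {..s - 1} (x3 j) \<omega>) (x3 j s \<omega>)"
      by (subst restrict_traj) (auto simp: traj_def)
  qed simp
  have past_traj: "past (traj {..n} (x3 j) \<omega>) = traj {..t - 1} (x3 j) \<omega>" if "t \<le> n" for n \<omega>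
    unfolding past_def using that by (intro restrict_traj) auto
  have w3_eq: "w3 j \<omega> = W (traj {..T} (x3 j) \<omega>)" if "\<omega> \<in> space Q" for \<omega>
    using w3[OF that] w1[OF that] x12[OF that]
    by (simp only: W_def wt_def qs_traj past_traj[OF tT] T_def[symmetric] p_def[symmetric])
  have w2_eq: "w2 j \<omega> = v (traj {..t} (x3 j) \<omega>)" if \<omega>: "\<omega> \<in> space Q" for \<omega>
  proof -
    have "x2 j t \<omega> = x3 j t \<omega>"
      using fun_cong[OF x3_past[OF \<omega>], of t] by (simp add: traj_def)
    moreover have "qs t (traj {..t} (x3 j) \<omega>) = q t y (traj {..t - 1} (x3 j) \<omega>) (x3 j t \<omega>)"
      by (simp add: qs_traj)
    ultimately show ?thesis
      using w2[OF \<omega>] w1[OF \<omega>] x12[OF \<omega>] x3_past[OF \<omega>, symmetric]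
      by (simp only: v_def wt_def past_traj[OF order_refl] T_def[symmetric] p_def[symmetric])
  qed

  have restrict_t: "restrict (restrict z {..t}) {..t - 1} = restrict z {..t - 1}" for z :: "nat \<Rightarrow> 'a"
    by (auto simp: restrict_def fun_eq_iff)
  have qs_t: "qs t z = qt z" for z
    by (simp add: qs_def qt_def)
  \<comment> \<open>\<open>qs T\<close> is the time-\<open>t\<close> factor times the future
    product. Where the full posterior is positive, so is its marginal, hence
    \<open>post_cond\<close> is positive and \<open>cover_future\<close> keeps the future product
    away from 0. The indicator thus depends on the first coordinates, up to \<open>t\<close>,
    only.\<close>
  have qs_T: "AE z in Pi\<^sub>M {..T} M. post M N f T T y z \<noteq> 0 \<longrightarrow> (qs T z \<noteq> 0 \<longleftrightarrow> qt (restrict z {..t}) \<noteq> 0)"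
    using AE_post_marginal_pos[OF model tT y'] cover_future[unfolded supp_covers_def T_def[symmetric]]
      AE_space
  proof eventually_elim
    case (elim z)
    have full: "restrict z {..T} = z"
      using elim(3) by (auto simp: space_PiM PiE_restrict)
    have "qt (restrict z {..t}) = q t y (restrict z {..t - 1}) (z t)"
      unfolding qt_def by (simp only: restrict_t restrict_apply' atMost_iff order_refl)
    then have "qs T z = qt (restrict z {..t}) * (\<Prod>s = t + 1..T. q s y (restrict z {..s - 1}) (z s))"
      unfolding qs_def using tT by (simp add: prod.atLeast_Suc_atMost)
    moreover have "(\<Prod>s = t + 1..T. q s y (restrict z {..s - 1}) (z s)) \<noteq> 0" if "post M N f T T y z \<noteq> 0"
    proof -
      have pos: "0 < post M N f T T y z"
        using that post_nn[of T T z] by simp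
      then have "0 < post_cond M N f T t T y z"
        using elim(1) by (simp add: post_cond_def full)
      then show ?thesis
        using elim(2) by (intro less_imp_neq[symmetric]) blast
    qed
    ultimately show ?case
      by (simp only: mult_eq_0_iff) blast
  qed
  have past_t: "past (restrict z {..t}) = past z" for z
    unfolding past_def by (rule restrict_t)

  have tower: "(\<integral>\<^sup>+\<omega>. ennreal (w3 j \<omega>) * g (traj {..t} (x3 j) \<omega>) \<partial>Q) =
      (\<integral>\<^sup>+\<omega>. ennreal (v (traj {..t} (x3 j) \<omega>)) * g (traj {..t} (x3 j) \<omega>) \<partial>Q)"
    if g: "g \<in> borel_measurable (Pi\<^sub>M {..t} M)" for g
  proof -
    \<comment> \<open>The test function together with the indicator, a function of the trajectory up
      to \<open>t\<close>. The normalising constant \<open>C\<close> will be attached to it, since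
      the marginalisation identity concerns unnormalised densities.\<close>
    define H :: "(nat \<Rightarrow> 'a) \<Rightarrow> ennreal"
      where "H z = (if p (past z) \<noteq> 0 \<and> r (past z) \<noteq> 0 \<and> qt z \<noteq> 0 then 1 else 0) * g z" for z
    have [measurable]: "(\<lambda>z. p (past z)) \<in> borel_measurable (Pi\<^sub>M {..t} M)"
        "(\<lambda>z. r (past z)) \<in> borel_measurable (Pi\<^sub>M {..t} M)" "qt \<in> borel_measurable (Pi\<^sub>M {..t} M)"
      using measurable_compose[OF past_meas p_meas] measurable_compose[OF past_meas r_meas]
        qs_meas[OF tT] by (simp_all add: qs_t[abs_def])
    have H: "H \<in> borel_measurable (Pi\<^sub>M {..t} M)"
      unfolding H_def using g by measurable
    have g': "(\<lambda>z. g (restrict z {..t})) \<in> borel_measurable (Pi\<^sub>M {..T} M)"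
      by (rule measurable_compose[OF measurable_restrict_subset g]) (use tT in auto)
    have HC: "(\<lambda>z. H z / C) \<in> borel_measurable (Pi\<^sub>M {..t} M)"
      using H by measurable
    have "(\<integral>\<^sup>+\<omega>. ennreal (w3 j \<omega>) * g (traj {..t} (x3 j) \<omega>) \<partial>Q) =
        (\<integral>\<^sup>+\<omega>. ennreal (wt T (post M N f T T y) (traj {..T} (x3 j) \<omega>)) *
          g (restrict (traj {..T} (x3 j) \<omega>) {..t}) \<partial>Q)"
      using tT by (intro nn_integral_cong) (simp add: w3_eq W_def restrict_traj)
    also have "\<dots> = (\<integral>\<^sup>+z. ennreal (post M N f T T y z) *
        ((if p (past z) \<noteq> 0 \<and> r (past z) \<noteq> 0 \<and> qs T z \<noteq> 0 then 1 else 0) * g (restrict z {..t})) \<partial>Pi\<^sub>M {..T} M)"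
      using tT order_refl postT_meas post_nn g' by (rule integral_wt)
    also have "\<dots> = (\<integral>\<^sup>+z. joint_dens M N f T T y z * (H (restrict z {..t}) / C) \<partial>Pi\<^sub>M {..T} M)"
    proof (rule nn_integral_cong_AE)
      from qs_T AE_ennreal_post[OF model order_refl y']
      show "AE z in Pi\<^sub>M {..T} M. ennreal (post M N f T T y z) *
          ((if p (past z) \<noteq> 0 \<and> r (past z) \<noteq> 0 \<and> qs T z \<noteq> 0 then 1 else 0) * g (restrict z {..t})) =
          joint_dens M N f T T y z * (H (restrict z {..t}) / C)"
      proof eventually_elim
        case (elim z)
        show ?case
        \<comment> \<open>At posterior value 0 the indicators may differ, but both sides vanish;
          elsewhere \<open>qs_T\<close> identifies them.\<close>
        proof (cases "post M N f T T y z = 0")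
          case True
          then have "joint_dens M N f T T y z / C = 0"
            using elim(2) by (simp add: C_def)
          then show ?thesis
            using True by (simp add: ennreal_divide_times[symmetric])
        next
          case False
          then have "(if p (past z) \<noteq> 0 \<and> r (past z) \<noteq> 0 \<and> qs T z \<noteq> 0 then 1 else 0) * g (restrict z {..t}) =
              H (restrict z {..t})"
            using elim(1) by (simp add: H_def past_t)
          then show ?thesis
            by (simp only: elim(2) C_def[symmetric] ennreal_divide_times)
        qed
      qed
    qed
    \<comment> \<open>The future states are integrated out here; the remaining steps undo the
      rewriting at horizon \<open>t\<close>.\<close>
    also have "\<dots> = (\<integral>\<^sup>+z. joint_dens M N f T t y z * (H z / C) \<partial>Pi\<^sub>M {..t} M)"
      using model tT y'(1) HC by (rule joint_dens_marginal)
    also have "\<dots> = (\<integral>\<^sup>+z. ennreal (post M N f T t y z) *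
        ((if p (past z) \<noteq> 0 \<and> r (past z) \<noteq> 0 \<and> qs t z \<noteq> 0 then 1 else 0) * g z) \<partial>Pi\<^sub>M {..t} M)"
    proof (rule nn_integral_cong_AE)
      from AE_ennreal_post[OF model tT y']
      show "AE z in Pi\<^sub>M {..t} M. joint_dens M N f T t y z * (H z / C) = ennreal (post M N f T t y z) *
          ((if p (past z) \<noteq> 0 \<and> r (past z) \<noteq> 0 \<and> qs t z \<noteq> 0 then 1 else 0) * g z)"
        by eventually_elim
          (simp only: qs_t H_def[symmetric] C_def[symmetric] ennreal_divide_times)
    qed
    also have "\<dots> = (\<integral>\<^sup>+\<omega>. ennreal (v (traj {..t} (x3 j) \<omega>)) * g (traj {..t} (x3 j) \<omega>) \<partial>Q)"
      unfolding v_def using order_refl tT postt_meas post_nn g by (rule integral_wt[symmetric])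
    finally show ?thesis .
  qed

  have w3_meas: "w3 j \<in> borel_measurable Q"
    using measurable_compose[OF trajT W_meas] w3_eq by (simp cong: measurable_cong)
  have w3_nn: "0 \<le> w3 j \<omega>" if "\<omega> \<in> space Q" for \<omega>
    using wt_nn[OF measurable_space[OF trajT that] tT order_refl post_nn] w3_eq[OF that] by (simp add: W_def)
  have v_nn: "0 \<le> v z" if "z \<in> space (Pi\<^sub>M {..t} M)" for z
    unfolding v_def using that order_refl tT post_nn by (rule wt_nn)
  have var: "ext_variance Q (\<lambda>\<omega>. w2 j \<omega> * h (traj {..t} (x2 j) \<omega>)) \<le>
      ext_variance Q (\<lambda>\<omega>. w3 j \<omega> * h (traj {..t} (x2 j) \<omega>))"
    if h: "h \<in> borel_measurable (Pi\<^sub>M {..t} M)" for h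
  proof -
    have "ext_variance Q (\<lambda>\<omega>. v (traj {..t} (x3 j) \<omega>) * h (traj {..t} (x3 j) \<omega>)) \<le>
        ext_variance Q (\<lambda>\<omega>. w3 j \<omega> * h (traj {..t} (x3 j) \<omega>))"
      by (rule Q.ext_variance_tower_le[where S = "Pi\<^sub>M {..t} M" and v = v and h = h,
            OF trajt w3_meas v_meas h w3_nn v_nn tower])
    then show ?thesis
      by (simp add: ext_variance_def w2_eq x3_past cong: nn_integral_cong Bochner_Integration.integral_cong)
  qed
  show ?thesis
    \<comment> \<open>The claim for the bare weights is the case of the constant function 1.\<close>
    using var[of "\<lambda>_. 1"] var by simp
qed

end
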